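(* Let $G_n$ be the random Gram matrix of size $n$, let $M$ be the $t\times t$ matrix of second moments of the underlying random vector $w$, and let $c_0,\dots,c_t$ be the sign-adjusted coefficients of the characteristic polynomial of $M$, defined by $$\det(\lambda I - M) = c_0\lambda^t - c_1\lambda^{t-1} + \cdots + (-1)^t c_t,$$ with $c_n=0$ for $n>t$. Then for every integer $n\ge 0$, $$E(\det(G_n)) = n!\, c_n$$ and $$E(\operatorname{perm}(G_n)) = n!\,\cdot\,[x^n]\,\left(1 - c_1 x + c_2 x^2 - \cdots + (-1)^t c_t x^t\right)^{-1},$$ where $[x^n]F(x)$ denotes the coefficient of $x^n$ in the formal power series $F(x)$.
   Context: Let $t\ge 1$ be an integer and let $w=(w_1,\dots,w_t)^T$ be a random vector whose components are real random variables (not necessarily independent or identically distributed), with all second moments $E(w_iw_j)$ finite. The matrix of second moments is the $t\times t$ matrix $M$ with $M_{ij}=E(w_iw_j)$, $1\le i,j\le t$. For each $n\ge 0$, let $w^{(1)},\dots,w^{(n)}$ be $n$ independent random vectors, each with the same distribution as $w$; let $A$ be the $t\times n$ matrix with columns $w^{(1)},\dots,w^{(n)}$. The random Gram matrix of size $n$ is the $n\times n$ matrix $G_n=A^TA$, so that $(G_n)_{ij}=w^{(i)}\cdot w^{(j)}$. $E$ denotes expectation, and $\operatorname{perm}(B)=\sum_{\sigma\in S_n}\prod_{i=1}^n B_{i,\sigma(i)}$ is the permanent of an $n\times n$ matrix $B$. By convention the determinant and permanent of the $0\times 0$ matrix equal $1$. *)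

theory Defs
  imports
    "HOL-Probability.Probability"
    "HOL-Computational_Algebra.Formal_Power_Series"
    "Jordan_Normal_Form.Char_Poly"
begin

text \<open>A random vector with \<open>t\<close> real components is a measurable map into this space. Its points are
  functions on \<open>{..<t}\<close>, extended by \<open>undefined\<close>; all indices are 0-based.\<close>

abbreviation vec_space :: "nat \<Rightarrow> (nat \<Rightarrow> real) measure" where
  "vec_space t \<equiv> (\<Pi>\<^sub>M i\<in>{..<t}. borel)"

definition second_moment_matrix :: "'b measure \<Rightarrow> nat \<Rightarrow> ('b \<Rightarrow> nat \<Rightarrow> real) \<Rightarrow> real mat" where
  "second_moment_matrix Q t w = Matrix.mat t t (\<lambda>(i, j). prob_space.expectation Q (\<lambda>x. w x i * w x j))"

definition sample_matrix :: "nat \<Rightarrow> nat \<Rightarrow> (nat \<Rightarrow> 'a \<Rightarrow> nat \<Rightarrow> real) \<Rightarrow> 'a \<Rightarrow> real mat" where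
  "sample_matrix t n W x = Matrix.mat t n (\<lambda>(i, j). W j x i)"

definition random_gram_matrix :: "nat \<Rightarrow> nat \<Rightarrow> (nat \<Rightarrow> 'a \<Rightarrow> nat \<Rightarrow> real) \<Rightarrow> 'a \<Rightarrow> real mat" where
  "random_gram_matrix t n W x = transpose_mat (sample_matrix t n W x) * sample_matrix t n W x"

text \<open>Non-square matrices get permanent 0, as they get determinant 0 in the library.\<close>

definition perm :: "'a::comm_ring_1 mat \<Rightarrow> 'a" where
  "perm B = (if dim_row B = dim_col B
     then (\<Sum>p | p permutes {0..<dim_row B}. \<Prod>i = 0..<dim_row B. B $$ (i, p i)) else 0)"

definition signed_char_coeff :: "'a::comm_ring_1 mat \<Rightarrow> nat \<Rightarrow> 'a" where
  "signed_char_coeff B k =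
     (if k \<le> dim_row B then (- 1) ^ k * coeff (char_poly B) (dim_row B - k) else 0)"

lemma char_poly_eq_sum_signed_char_coeff:
  fixes B :: "'a::comm_ring_1 mat"
  assumes B: "B \<in> carrier_mat t t"
  shows "char_poly B = (\<Sum>k\<le>t. monom ((- 1) ^ k * signed_char_coeff B k) (t - k))"
proof -
  have "degree (char_poly B) = t"
    using degree_monic_char_poly[OF B] by simp
  then have "char_poly B = (\<Sum>i\<le>t. monom (coeff (char_poly B) i) i)"
    using poly_as_sum_of_monoms[of "char_poly B"] by simp
  also have "\<dots> = (\<Sum>k\<le>t. monom (coeff (char_poly B) (t - k)) (t - k))"
    by (rule sum.reindex_bij_witness[of _ "\<lambda>k. t - k" "\<lambda>k. t - k"]) auto
  also have "\<dots> = (\<Sum>k\<le>t. monom ((- 1) ^ k * signed_char_coeff B k) (t - k))"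
  proof (rule sum.cong[OF refl])
    fix k assume "k \<in> {..t}"
    then have "(- 1) ^ k * signed_char_coeff B k = coeff (char_poly B) (t - k)"
      using B by (simp add: signed_char_coeff_def mult.assoc[symmetric] power_add[symmetric])
    then show "monom (coeff (char_poly B) (t - k)) (t - k) =
        monom ((- 1) ^ k * signed_char_coeff B k) (t - k)"
      by simp
  qed
  finally show ?thesis .
qed

end

theory Submission
  imports Defs
begin

text \<open>
  Expand each entry of the Gram matrix \<open>G\<close> as a sum over the \<open>t\<close> coordinates. A product
  \<open>\<Prod>i. G (i, p i)\<close> becomes a sum over index functions \<open>f\<close> of products in which sample \<open>i\<close> occurs
  exactly twice, once for row \<open>i\<close> and once for column \<open>i\<close>, in the row that \<open>p\<close> sends to \<open>i\<close>.
  Independence therefore turns the expectation into a sum of products of second moments, and the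
  expected determinant and permanent of \<open>G\<close> are
  \[ \sum_f \det (M_{f i, f j})_{i,j} \qquad \mbox{and} \qquad
     \sum_f \mathrm{perm} (M_{f i, f j})_{i,j}. \]
  What remains is an identity about a square matrix \<open>M\<close>: these sums are \<open>n!\<close> times the
  \<open>n\<close>-th coefficients of \<open>det (1 + z M)\<close> and of \<open>1 / det (1 - z M)\<close>. (Up to the factor \<open>n!\<close> they are
  the traces of \<open>M\<close> on the exterior and on the symmetric power.)

  Both cases are treated at once, with a weight \<open>\<epsilon> = - 1\<close> or \<open>\<epsilon> = 1\<close> for odd permutations. Leaving one
  factor out of the trace gives a matrix, and asking which element the left-out point is mapped to
  gives a recursion for it. In generating functions, \<open>A\<close> for the traces and the matrix \<open>X\<close> for the
  partial traces, it says
  \[ X = A M + \epsilon z M X, \qquad A' = \mathrm{tr}\, X, \]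
  and these equations together with \<open>A(0) = 1\<close> determine \<open>A\<close> and \<open>X\<close>
  (\<open>twisted_trace_eq_fps_coeff\<close>). It is then enough to exhibit a solution built from the
  characteristic polynomial. One comes from the adjugate of \<open>\<lambda> - M\<close>, the resolvent cleared of its
  denominator: with the polynomial coefficients read backwards it is a matrix \<open>Y\<close> with
  \<open>(1 + \<sigma> z M) Y = E\<close> and \<open>E' = \<sigma> tr (M Y)\<close>, where \<open>E = det (1 + \<sigma> z M)\<close>; the second equation is
  Jacobi's formula (\<open>char_poly_resolvent_fps\<close>). For the determinant take \<open>\<sigma> = 1\<close>, \<open>A = E\<close> and
  \<open>X = M Y\<close>; for the permanent take \<open>\<sigma> = - 1\<close>, \<open>A = 1 / E\<close> and \<open>X = A\<^sup>2 M Y\<close>.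
\<close>

section \<open>Traces of permutations twisted by a tensor power\<close>

text \<open>At \<open>\<epsilon> = 1\<close> this is the trivial character and at \<open>\<epsilon> = - 1\<close> the sign.\<close>

definition parity_weight :: "'a::comm_ring_1 \<Rightarrow> ('i \<Rightarrow> 'i) \<Rightarrow> 'a" where
  "parity_weight \<epsilon> p = (if evenperm p then 1 else \<epsilon>)"

text \<open>The trace of \<open>M\<^sup>\<otimes>\<^sup>S\<close> composed with the weighted sum of all permutations of the tensor
  factors; equivalently, the sum over \<open>f\<close> of the permanents or determinants of the matrices
  \<open>(M (f i) (f j))\<close>.\<close>

definition twisted_trace ::
    "'a::comm_ring_1 \<Rightarrow> 'v set \<Rightarrow> ('v \<Rightarrow> 'v \<Rightarrow> 'a) \<Rightarrow> 'i set \<Rightarrow> 'a" where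
  "twisted_trace \<epsilon> T M S =
     (\<Sum>f \<in> S \<rightarrow>\<^sub>E T. \<Sum>p | p permutes S. parity_weight \<epsilon> p * (\<Prod>i\<in>S. M (f i) (f (p i))))"

text \<open>All tensor factors except the one at \<open>r\<close> are traced out: \<open>a\<close> is the row index and \<open>b\<close> the column
  index at \<open>r\<close>. This is the entry \<open>(a, b)\<close> of a matrix whose trace is the full trace.\<close>

definition twisted_partial_trace ::
    "'a::comm_ring_1 \<Rightarrow> 'v set \<Rightarrow> ('v \<Rightarrow> 'v \<Rightarrow> 'a) \<Rightarrow> 'i set \<Rightarrow> 'i \<Rightarrow> 'v \<Rightarrow> 'v \<Rightarrow> 'a" where
  "twisted_partial_trace \<epsilon> T M S r a b =
     (\<Sum>f \<in> (S - {r}) \<rightarrow>\<^sub>E T. \<Sum>p | p permutes S.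
        parity_weight \<epsilon> p * (\<Prod>i\<in>S. M ((f(r := a)) i) ((f(r := b)) (p i))))"

lemma sum_PiE_extract:
  assumes "r \<in> S"
  shows "(\<Sum>f \<in> S \<rightarrow>\<^sub>E T. F f) = (\<Sum>a\<in>T. \<Sum>f \<in> (S - {r}) \<rightarrow>\<^sub>E T. F (f(r := a)))"
proof -
  have S: "S = insert r (S - {r})"
    using assms by auto
  have inj: "inj_on (\<lambda>(y, g). g(r := y)) (T \<times> ((S - {r}) \<rightarrow>\<^sub>E T))"
    by (rule inj_combinator) simp
  have "(\<Sum>f \<in> S \<rightarrow>\<^sub>E T. F f) = (\<Sum>f \<in> (\<lambda>(y, g). g(r := y)) ` (T \<times> ((S - {r}) \<rightarrow>\<^sub>E T)). F f)"
    by (subst S, subst PiE_insert_eq) simp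
  also have "\<dots> = (\<Sum>(a, f) \<in> T \<times> ((S - {r}) \<rightarrow>\<^sub>E T). F (f(r := a)))"
    by (subst sum.reindex[OF inj]) (simp add: case_prod_unfold)
  finally show ?thesis
    by (simp add: sum.cartesian_product)
qed

lemma twisted_trace_eq_sum_partial_trace:
  assumes "r \<in> S"
  shows "twisted_trace \<epsilon> T M S = (\<Sum>a\<in>T. twisted_partial_trace \<epsilon> T M S r a a)"
  unfolding twisted_trace_def twisted_partial_trace_def by (rule sum_PiE_extract[OF assms])

lemma parity_weight_transpose_comp:
  assumes "\<epsilon> * \<epsilon> = 1" and "finite S" and "q permutes S" and "r \<noteq> s"
  shows "parity_weight \<epsilon> (Transposition.transpose r s \<circ> q) = \<epsilon> * parity_weight \<epsilon> q"
proof -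
  have "permutation q"
    using assms by (auto simp: permutation_permutes)
  then show ?thesis
    using assms by (simp add: parity_weight_def evenperm_comp permutation_swap_id evenperm_swap)
qed

text \<open>The Laplace expansion along row \<open>r\<close>, with a permutation of \<open>insert r S\<close> written as the transposition
  of \<open>r\<close> and \<open>s\<close> after a permutation \<open>q\<close> of \<open>S\<close>, where \<open>s\<close> is the image of \<open>r\<close>. If \<open>s = r\<close>, the point \<open>r\<close>
  contributes \<open>M a b\<close> and separates from the rest. Otherwise the path that started at \<open>r\<close> with index
  \<open>a\<close> takes one step to \<open>s\<close>, which has some index \<open>c\<close>, and continues as a path of \<open>q\<close> that starts at \<open>s\<close>
  and still has to end with index \<open>b\<close>; the removed transposition costs a factor \<open>\<epsilon>\<close>.\<close>

lemma twisted_partial_trace_insert: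
  assumes e: "\<epsilon> * \<epsilon> = 1" and fin: "finite S" and r: "r \<notin> S"
  shows "twisted_partial_trace \<epsilon> T M (insert r S) r a b =
     M a b * twisted_trace \<epsilon> T M S +
     \<epsilon> * (\<Sum>s\<in>S. \<Sum>c\<in>T. M a c * twisted_partial_trace \<epsilon> T M S s c b)"
proof -
  let ?t = "\<lambda>f s q. parity_weight \<epsilon> (Transposition.transpose r s \<circ> q) *
     (M a ((f(r := b)) s) * (\<Prod>i\<in>S. M (f i) ((f(r := b)) (Transposition.transpose r s (q i)))))"
  have step: "twisted_partial_trace \<epsilon> T M (insert r S) r a b =
     (\<Sum>f \<in> S \<rightarrow>\<^sub>E T. \<Sum>s\<in>insert r S. \<Sum>q | q permutes S. ?t f s q)"
    unfolding twisted_partial_trace_def sum_over_permutations_insert[OF fin r]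
  proof (intro sum.cong refl)
    show "insert r S - {r} \<rightarrow>\<^sub>E T = S \<rightarrow>\<^sub>E T"
      using r by simp
  next
    fix f s q assume "q \<in> {q. q permutes S}"
    then have q: "q r = r"
      using r by (auto simp: permutes_def)
    have "(\<Prod>i\<in>insert r S. M ((f(r := a)) i) ((f(r := b)) ((Transposition.transpose r s \<circ> q) i))) =
        M a ((f(r := b)) s) * (\<Prod>i\<in>S. M ((f(r := a)) i) ((f(r := b)) (Transposition.transpose r s (q i))))"
      using fin r q by simp
    also have "(\<Prod>i\<in>S. M ((f(r := a)) i) ((f(r := b)) (Transposition.transpose r s (q i)))) =
        (\<Prod>i\<in>S. M (f i) ((f(r := b)) (Transposition.transpose r s (q i))))"
      using r by (intro prod.cong refl) auto
    finally show "parity_weight \<epsilon> (Transposition.transpose r s \<circ> q) *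
         (\<Prod>i\<in>insert r S. M ((f(r := a)) i) ((f(r := b)) ((Transposition.transpose r s \<circ> q) i))) = ?t f s q"
      by simp
  qed
  have fixed: "(\<Sum>f \<in> S \<rightarrow>\<^sub>E T. \<Sum>q | q permutes S. ?t f r q) = M a b * twisted_trace \<epsilon> T M S"
    unfolding twisted_trace_def sum_distrib_left
  proof (intro sum.cong refl)
    fix f q assume "q \<in> {q. q permutes S}"
    then have q: "q i \<noteq> r" if "i \<in> S" for i
      using r that permutes_in_image[of q S i] by auto
    have "(\<Prod>i\<in>S. M (f i) ((f(r := b)) (Transposition.transpose r r (q i)))) = (\<Prod>i\<in>S. M (f i) (f (q i)))"
      using q by (intro prod.cong refl) simp
    then show "?t f r q = M a b * (parity_weight \<epsilon> q * (\<Prod>i\<in>S. M (f i) (f (q i))))"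
      by simp
  qed
  have moved: "(\<Sum>f \<in> S \<rightarrow>\<^sub>E T. \<Sum>q | q permutes S. ?t f s q) =
      \<epsilon> * (\<Sum>c\<in>T. M a c * twisted_partial_trace \<epsilon> T M S s c b)" if s: "s \<in> S" for s
    unfolding sum_PiE_extract[OF s] twisted_partial_trace_def sum_distrib_left
  proof (intro sum.cong refl)
    fix c f q assume "q \<in> {q. q permutes S}"
    then have qS: "q permutes S" by simp
    have rs: "r \<noteq> s"
      using r s by auto
    \<comment> \<open>The column index \<open>b\<close> moves from \<open>r\<close> to the point \<open>s\<close>, because \<open>q\<close> reaches \<open>s\<close> exactly where
      the original permutation reaches \<open>r\<close>.\<close>
    have "((f(s := c))(r := b)) (Transposition.transpose r s (q i)) = (f(s := b)) (q i)" if "i \<in> S" for i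
      using permutes_in_image[OF qS, of i] r s that rs
      by (cases "q i = s") (auto simp: Transposition.transpose_def)
    then show "?t (f(s := c)) s q =
        \<epsilon> * (M a c * (parity_weight \<epsilon> q * (\<Prod>i\<in>S. M ((f(s := c)) i) ((f(s := b)) (q i)))))"
      using rs by (simp add: parity_weight_transpose_comp[OF e fin qS rs] mult_ac)
  qed
  have "twisted_partial_trace \<epsilon> T M (insert r S) r a b =
      (\<Sum>s\<in>insert r S. \<Sum>f \<in> S \<rightarrow>\<^sub>E T. \<Sum>q | q permutes S. ?t f s q)"
    unfolding step by (rule sum.swap)
  also have "\<dots> = (\<Sum>f \<in> S \<rightarrow>\<^sub>E T. \<Sum>q | q permutes S. ?t f r q) +
      (\<Sum>s\<in>S. \<Sum>f \<in> S \<rightarrow>\<^sub>E T. \<Sum>q | q permutes S. ?t f s q)"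
    by (rule sum.insert[OF fin r])
  also have "(\<Sum>s\<in>S. \<Sum>f \<in> S \<rightarrow>\<^sub>E T. \<Sum>q | q permutes S. ?t f s q) =
      (\<Sum>s\<in>S. \<epsilon> * (\<Sum>c\<in>T. M a c * twisted_partial_trace \<epsilon> T M S s c b))"
    by (rule sum.cong[OF refl moved])
  finally show ?thesis
    unfolding fixed by (simp only: sum_distrib_left)
qed

text \<open>The hypotheses on \<open>A\<close> and \<open>X\<close> are the recursions for the full and the partial trace in terms of
  exponential generating functions in the size of \<open>S\<close>. The induction carries both traces along:
  the partial trace over a set with \<open>n + 1\<close> elements has \<open>n\<close> points traced out, hence the shifted
  index \<open>n\<close> in its coefficient and factorial.\<close>

lemma twisted_trace_eq_fps_coeff:
  fixes M :: "'v \<Rightarrow> 'v \<Rightarrow> 'a::{comm_ring_1,ring_char_0}" and A :: "'a fps" and X :: "'v \<Rightarrow> 'v \<Rightarrow> 'a fps"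
  assumes e: "\<epsilon> * \<epsilon> = 1" and A0: "fps_nth A 0 = 1"
    and X: "\<And>a b. a \<in> T \<Longrightarrow> b \<in> T \<Longrightarrow>
      X a b = fps_const (M a b) * A + fps_const \<epsilon> * fps_X * (\<Sum>c\<in>T. fps_const (M a c) * X c b)"
    and A': "fps_deriv A = (\<Sum>a\<in>T. X a a)"
    and fin: "finite S"
  shows "twisted_trace \<epsilon> T M S = fact (card S) * fps_nth A (card S)"
proof -
  have X0: "fps_nth (X a b) 0 = M a b" if "a \<in> T" "b \<in> T" for a b
    using that by (subst X) (auto simp: A0)
  have XSuc: "fps_nth (X a b) (Suc n) =
      M a b * fps_nth A (Suc n) + \<epsilon> * (\<Sum>c\<in>T. M a c * fps_nth (X c b) n)"
    if "a \<in> T" "b \<in> T" for a b n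
    using that by (subst X) (auto simp: mult.assoc fps_sum_nth)
  have ASuc: "of_nat (Suc n) * fps_nth A (Suc n) = (\<Sum>a\<in>T. fps_nth (X a a) n)" for n
    using arg_cong[OF A', of "\<lambda>F. fps_nth F n"] by (simp add: fps_sum_nth)
  have partial: "twisted_partial_trace \<epsilon> T M (insert r S) r a b = fact n * fps_nth (X a b) n"
    if "finite S" "card S = n" "r \<notin> S" "a \<in> T" "b \<in> T" "twisted_trace \<epsilon> T M S = fact n * fps_nth A n"
       "\<And>s c. s \<in> S \<Longrightarrow> c \<in> T \<Longrightarrow>
          twisted_partial_trace \<epsilon> T M S s c b = fact (n - 1) * fps_nth (X c b) (n - 1)"
    for S r a b n
  proof (cases n)
    case 0
    with that show ?thesis
      by (simp add: twisted_partial_trace_insert[OF e] X0 A0)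
  next
    case (Suc m)
    have "(\<Sum>s\<in>S. \<Sum>c\<in>T. M a c * twisted_partial_trace \<epsilon> T M S s c b) =
        (\<Sum>s\<in>S. \<Sum>c\<in>T. M a c * (fact m * fps_nth (X c b) m))"
      using that Suc by (intro sum.cong refl) simp
    also have "\<dots> = of_nat (Suc m) * fact m * (\<Sum>c\<in>T. M a c * fps_nth (X c b) m)"
      using that Suc by (simp add: sum_distrib_left mult_ac)
    finally show ?thesis
      using that Suc
      by (simp add: twisted_partial_trace_insert[OF e] XSuc algebra_simps)
  qed
  have "twisted_trace \<epsilon> T M S = fact n * fps_nth A n \<and>
      (\<forall>r\<in>S. \<forall>a\<in>T. \<forall>b\<in>T. twisted_partial_trace \<epsilon> T M S r a b = fact (n - 1) * fps_nth (X a b) (n - 1))"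
    if "finite S" "card S = n" for S n
    using that
  proof (induction n arbitrary: S)
    case 0
    then show ?case
      by (simp add: twisted_trace_def A0 parity_weight_def)
  next
    case (Suc n)
    have root: "twisted_partial_trace \<epsilon> T M S r a b = fact n * fps_nth (X a b) n"
      if "r \<in> S" "a \<in> T" "b \<in> T" for r a b
    proof -
      have S': "finite (S - {r})" "card (S - {r}) = n" "S = insert r (S - {r})"
        using Suc.prems that by auto
      show ?thesis
        using partial[OF S'(1,2), of r a b] Suc.IH[OF S'(1,2)] S'(3) that by auto
    qed
    obtain r where r: "r \<in> S"
      using Suc.prems by fastforce
    have "twisted_trace \<epsilon> T M S = fact n * (\<Sum>a\<in>T. fps_nth (X a a) n)"
      unfolding twisted_trace_eq_sum_partial_trace[OF r] sum_distrib_left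
      using root[OF r] by (intro sum.cong refl) simp
    also have "\<dots> = fact (Suc n) * fps_nth A (Suc n)"
      unfolding ASuc[symmetric] by (simp add: algebra_simps)
    finally show ?case
      using root by simp
  qed
  then show ?thesis
    using fin by blast
qed

section \<open>The resolvent and the characteristic polynomial\<close>

text \<open>The diagonal of the adjugate consists of the characteristic polynomials of the principal
  submatrices of size one less, and their sum is the derivative.\<close>

lemma adjugate_char_poly_matrix_trace:
  fixes B :: "'a::idom mat"
  assumes B: "B \<in> carrier_mat t t"
  shows "(\<Sum>a<t. adj_mat (char_poly_matrix B) $$ (a, a)) = pderiv (char_poly B)"
proof -
  have "adj_mat (char_poly_matrix B) $$ (a, a) = char_poly (mat_delete B a a)" if a: "a < t" for a
  proof -
    have "mat_delete (char_poly_matrix B) a a = char_poly_matrix (mat_delete B a a)"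
      using B a by (intro eq_matI) (auto simp: mat_delete_def char_poly_matrix_def)
    moreover have "char_poly_matrix B \<in> carrier_mat t t"
      using B by simp
    ultimately show ?thesis
      using a by (simp add: adj_mat_def cofactor_def char_poly_def)
  qed
  then show ?thesis
    using pderiv_char_poly[OF B] by simp
qed

text \<open>The entry \<open>(a, b)\<close> of \<open>(\<lambda> - B) adj (\<lambda> - B) = det (\<lambda> - B)\<close>, with multiplication by \<open>\<lambda>\<close> written
  as a coefficient shift.\<close>

lemma adjugate_char_poly_matrix_entry:
  fixes B :: "'a::comm_ring_1 mat"
  assumes B: "B \<in> carrier_mat t t" and a: "a < t" and b: "b < t"
  shows "pCons 0 (adj_mat (char_poly_matrix B) $$ (a, b)) -
      (\<Sum>k<t. Polynomial.smult (B $$ (a, k)) (adj_mat (char_poly_matrix B) $$ (k, b))) =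
    (if a = b then char_poly B else 0)"
proof -
  let ?C = "char_poly_matrix B" and ?R = "adj_mat (char_poly_matrix B)"
  have C: "?C \<in> carrier_mat t t"
    using B by simp
  note R = adj_mat[OF C]
  have "(?C * ?R) $$ (a, b) = (\<Sum>k<t. ?C $$ (a, k) * ?R $$ (k, b))"
    using C R(1) a b by (auto simp: scalar_prod_def atLeast0LessThan intro!: sum.cong)
  also have "\<dots> = (\<Sum>k<t. (if a = k then pCons 0 (?R $$ (a, b)) else 0) - Polynomial.smult (B $$ (a, k)) (?R $$ (k, b)))"
    using B a by (intro sum.cong refl) (auto simp: char_poly_matrix_def algebra_simps)
  also have "\<dots> = pCons 0 (?R $$ (a, b)) - (\<Sum>k<t. Polynomial.smult (B $$ (a, k)) (?R $$ (k, b)))"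
    using a by (simp add: sum_subtractf sum.delta)
  finally show ?thesis
    unfolding R(2) using a b by (cases "a = b") (simp_all add: char_poly_def)
qed

text \<open>The Faddeev-LeVerrier recursion. \<open>Y j\<close> is up to the sign \<open>(- 1) ^ j\<close> the coefficient of
  \<open>\<lambda> ^ (t - 1 - j)\<close> in the adjugate of \<open>\<lambda> - B\<close>; the first two properties compare coefficients in
  \<open>(\<lambda> - B) adj (\<lambda> - B) = det (\<lambda> - B)\<close> and the third in \<open>tr adj (\<lambda> - B) = (det (\<lambda> - B))'\<close>. For \<open>j > t\<close>
  the truncated difference \<open>t - j\<close> is harmless, since then \<open>c j = 0\<close>.\<close>

lemma faddeev_leverrier:
  fixes B :: "'a::idom mat"
  assumes B: "B \<in> carrier_mat t t"
  defines "c \<equiv> signed_char_coeff B"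
  obtains Y :: "nat \<Rightarrow> nat \<Rightarrow> nat \<Rightarrow> 'a"
    where "\<And>a b. a < t \<Longrightarrow> b < t \<Longrightarrow> Y 0 a b = (if a = b then c 0 else 0)"
      and "\<And>j a b. a < t \<Longrightarrow> b < t \<Longrightarrow>
        Y (Suc j) a b + (\<Sum>k<t. B $$ (a, k) * Y j k b) = (if a = b then c (Suc j) else 0)"
      and "\<And>j. (\<Sum>a<t. Y j a a) = of_nat (t - j) * c j"
proof -
  define N where "N k a b = coeff (adj_mat (char_poly_matrix B) $$ (a, b)) k" for k a b
  define \<kappa> where "\<kappa> k = coeff (char_poly B) k" for k
  have c: "c j = (if j \<le> t then (- 1) ^ j * \<kappa> (t - j) else 0)" for j
    using B by (simp add: c_def signed_char_coeff_def \<kappa>_def)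
  have chi_top: "\<kappa> k = (if k = t then 1 else 0)" if "k \<ge> t" for k
    using degree_monic_char_poly[OF B] that by (auto simp: \<kappa>_def coeff_eq_0)
  have entry: "(case k of 0 \<Rightarrow> 0 | Suc m \<Rightarrow> N m a b) - (\<Sum>l<t. B $$ (a, l) * N k l b) =
      (if a = b then \<kappa> k else 0)" if "a < t" "b < t" for a b k
    using arg_cong[OF adjugate_char_poly_matrix_entry[OF B that], of "\<lambda>p. coeff p k"]
    by (auto simp: N_def \<kappa>_def coeff_sum coeff_pCons split: nat.splits)
  have N_Suc: "N k a b = (if a = b then \<kappa> (Suc k) else 0) + (\<Sum>l<t. B $$ (a, l) * N (Suc k) l b)"
    if "a < t" "b < t" for a b k
    using entry[OF that, of "Suc k"] by (simp add: algebra_simps)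
  have N_0: "(\<Sum>l<t. B $$ (a, l) * N 0 l b) = - (if a = b then \<kappa> 0 else 0)" if "a < t" "b < t" for a b
    using entry[OF that, of 0] by (simp add: minus_equation_iff)
  \<comment> \<open>The adjugate has degree below \<open>t\<close>. Its coefficients vanish for large \<open>k\<close>, and \<open>N_Suc\<close> carries
    this downwards as long as the characteristic polynomial has no coefficient at \<open>Suc k\<close>.\<close>
  have N_vanish: "N k a b = 0" if "a < t" "b < t" "t \<le> k" for a b k
  proof -
    define m where "m = Max ((\<lambda>(a, b). degree (adj_mat (char_poly_matrix B) $$ (a, b))) ` ({..<t} \<times> {..<t}))"
    have high: "N i a b = 0" if "a < t" "b < t" "m < i" for a b i
    proof -
      have "degree (adj_mat (char_poly_matrix B) $$ (a, b)) \<le> m"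
        unfolding m_def using that by (intro Max_ge) auto
      then show ?thesis
        using that by (simp add: N_def coeff_eq_0)
    qed
    show ?thesis
      using that
    proof (induction "Suc m - k" arbitrary: k a b)
      case 0
      then show ?case
        by (intro high) auto
    next
      case (Suc d)
      have "N (Suc k) l b = 0" if "l < t" for l
        using Suc that by (intro Suc.hyps(1)) auto
      then show ?case
        using N_Suc[of a b k] chi_top[of "Suc k"] Suc.prems by simp
    qed
  qed
  have N_trace: "(\<Sum>a<t. N k a a) = of_nat (Suc k) * \<kappa> (Suc k)" for k
    using arg_cong[OF adjugate_char_poly_matrix_trace[OF B], of "\<lambda>p. coeff p k"]
    by (simp add: N_def \<kappa>_def coeff_sum coeff_pderiv)
  define Y where "Y j a b = (if j < t then (- 1) ^ j * N (t - Suc j) a b else 0)" for j a b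
  show ?thesis
  proof (rule that[of Y])
    fix a b assume ab: "a < t" "b < t"
    then obtain s where s: "t = Suc s"
      by (cases t) auto
    show "Y 0 a b = (if a = b then c 0 else 0)"
      using N_Suc[OF ab, of s] N_vanish[of _ b t] ab s
      by (simp add: Y_def c)
  next
    fix j a b assume ab: "a < t" "b < t"
    consider "Suc j < t" | "Suc j = t" | "t < Suc j"
      by linarith
    then show "Y (Suc j) a b + (\<Sum>k<t. B $$ (a, k) * Y j k b) = (if a = b then c (Suc j) else 0)"
    proof cases
      case 1
      then have j: "t - Suc j = Suc (t - Suc (Suc j))"
        by simp
      have sum: "(\<Sum>k<t. B $$ (a, k) * Y j k b) = (- 1) ^ j * (\<Sum>k<t. B $$ (a, k) * N (t - Suc j) k b)"
        using 1 by (simp add: Y_def sum_distrib_left mult_ac)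
      show ?thesis
        unfolding sum using 1 N_Suc[OF ab, of "t - Suc (Suc j)"] j
        by (auto simp: Y_def c algebra_simps)
    next
      case 2
      have sum: "(\<Sum>k<t. B $$ (a, k) * Y j k b) = (- 1) ^ j * (\<Sum>k<t. B $$ (a, k) * N 0 k b)"
        using 2 by (auto simp: Y_def sum_distrib_left mult_ac)
      show ?thesis
        unfolding sum N_0[OF ab] using 2 by (auto simp: Y_def c)
    next
      case 3
      then show ?thesis
        by (simp add: Y_def c)
    qed
  next
    fix j
    show "(\<Sum>a<t. Y j a a) = of_nat (t - j) * c j"
    proof (cases "j < t")
      case True
      then have "t - j = Suc (t - Suc j)"
        by simp
      with True show ?thesis
        using N_trace[of "t - Suc j"]
        by (simp add: Y_def c sum_distrib_left[symmetric] mult_ac del: of_nat_Suc)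
    next
      case False
      then show ?thesis
        by (simp add: Y_def)
    qed
  qed
qed

text \<open>The series \<open>E\<close> is \<open>det (1 + \<sigma> z B)\<close> and \<open>Y\<close> is the adjugate of \<open>1 + \<sigma> z B\<close>, so the second
  property is Jacobi's formula for the derivative of a determinant. Only coefficients are compared,
  hence \<open>\<sigma>\<close> is arbitrary and merely rescales \<open>z\<close>.\<close>

lemma char_poly_resolvent_fps:
  fixes B :: "'a::idom mat" and \<sigma> :: 'a
  assumes B: "B \<in> carrier_mat t t"
  defines "E \<equiv> Abs_fps (\<lambda>k. \<sigma> ^ k * signed_char_coeff B k)"
  obtains Y :: "nat \<Rightarrow> nat \<Rightarrow> 'a fps"
    where "\<And>a b. a < t \<Longrightarrow> b < t \<Longrightarrow>
        Y a b + fps_const \<sigma> * fps_X * (\<Sum>k<t. fps_const (B $$ (a, k)) * Y k b) = (if a = b then E else 0)"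
      and "fps_deriv E = fps_const \<sigma> * (\<Sum>a<t. \<Sum>k<t. fps_const (B $$ (a, k)) * Y k a)"
proof -
  let ?c = "signed_char_coeff B"
  obtain Y where Y0: "\<And>a b. a < t \<Longrightarrow> b < t \<Longrightarrow> Y 0 a b = (if a = b then ?c 0 else 0)"
      and YSuc: "\<And>j a b. a < t \<Longrightarrow> b < t \<Longrightarrow>
        Y (Suc j) a b + (\<Sum>k<t. B $$ (a, k) * Y j k b) = (if a = b then ?c (Suc j) else 0)"
      and Ytr: "\<And>j. (\<Sum>a<t. Y j a a) = of_nat (t - j) * ?c j"
    using faddeev_leverrier[OF B] by blast
  define Z where "Z a b = Abs_fps (\<lambda>j. \<sigma> ^ j * Y j a b)" for a b
  \<comment> \<open>Taking the trace of \<open>YSuc\<close> gives \<open>t c - (t - Suc j) c\<close> for \<open>c = c (Suc j)\<close>.\<close>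
  have trace: "(\<Sum>a<t. \<Sum>k<t. B $$ (a, k) * Y j k a) = of_nat (Suc j) * ?c (Suc j)" for j
  proof -
    have "(\<Sum>a<t. \<Sum>k<t. B $$ (a, k) * Y j k a) = (\<Sum>a<t. ?c (Suc j) - Y (Suc j) a a)"
      using YSuc by (intro sum.cong refl) (simp add: eq_diff_eq add.commute)
    also have "\<dots> = of_nat t * ?c (Suc j) - of_nat (t - Suc j) * ?c (Suc j)"
      by (simp add: sum_subtractf Ytr)
    also have "\<dots> = of_nat (Suc j) * ?c (Suc j)"
    proof (cases "Suc j \<le> t")
      case True
      then have "of_nat t = (of_nat (t - Suc j) + of_nat (Suc j) :: 'a)"
        unfolding of_nat_add[symmetric] by simp
      then show ?thesis
        by (simp add: algebra_simps)
    next
      case False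
      then show ?thesis
        using B by (simp add: signed_char_coeff_def)
    qed
    finally show ?thesis .
  qed
  show ?thesis
  proof (rule that[of Z])
    fix a b assume ab: "a < t" "b < t"
    show "Z a b + fps_const \<sigma> * fps_X * (\<Sum>k<t. fps_const (B $$ (a, k)) * Z k b) = (if a = b then E else 0)"
    proof (rule fps_ext)
      fix n
      show "fps_nth (Z a b + fps_const \<sigma> * fps_X * (\<Sum>k<t. fps_const (B $$ (a, k)) * Z k b)) n =
          fps_nth (if a = b then E else 0) n"
      proof (cases n)
        case 0
        then show ?thesis
          using Y0[OF ab] by (simp add: Z_def E_def mult.assoc)
      next
        case (Suc j)
        have "fps_nth (Z a b + fps_const \<sigma> * fps_X * (\<Sum>k<t. fps_const (B $$ (a, k)) * Z k b)) n =
            \<sigma> ^ n * (Y (Suc j) a b + (\<Sum>k<t. B $$ (a, k) * Y j k b))"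
          using Suc by (simp add: Z_def mult.assoc fps_sum_nth sum_distrib_left algebra_simps)
        then show ?thesis
          unfolding YSuc[OF ab] using Suc by (simp add: E_def)
      qed
    qed
  next
    show "fps_deriv E = fps_const \<sigma> * (\<Sum>a<t. \<Sum>k<t. fps_const (B $$ (a, k)) * Z k a)"
    proof (rule fps_ext)
      fix j
      have "fps_nth (fps_const \<sigma> * (\<Sum>a<t. \<Sum>k<t. fps_const (B $$ (a, k)) * Z k a)) j =
          \<sigma> ^ Suc j * (\<Sum>a<t. \<Sum>k<t. B $$ (a, k) * Y j k a)"
        by (simp add: Z_def fps_sum_nth sum_distrib_left algebra_simps)
      then show "fps_nth (fps_deriv E) j =
          fps_nth (fps_const \<sigma> * (\<Sum>a<t. \<Sum>k<t. fps_const (B $$ (a, k)) * Z k a)) j"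
        unfolding trace by (simp add: E_def algebra_simps)
    qed
  qed
qed


section \<open>Evaluation of the twisted traces\<close>

text \<open>Multiplying \<open>(1 + z B) Y = E\<close> by \<open>B\<close> shows that \<open>A = E\<close>, \<open>X = B Y\<close> solve the recursions for
  \<open>\<epsilon> = - 1\<close>. Combinatorially, the terms with a repeated index cancel and \<open>E\<close> generates the sums of
  principal minors.\<close>

lemma twisted_trace_minus_one:
  fixes B :: "'a::{idom,ring_char_0} mat"
  assumes B: "B \<in> carrier_mat t t" and S: "finite S"
  shows "twisted_trace (- 1) {..<t} (\<lambda>a b. B $$ (a, b)) S =
    fact (card S) * signed_char_coeff B (card S)"
proof -
  let ?E = "Abs_fps (\<lambda>k. 1 ^ k * signed_char_coeff B k)"
  obtain Y where Y: "\<And>a b. a < t \<Longrightarrow> b < t \<Longrightarrow>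
        Y a b + fps_const 1 * fps_X * (\<Sum>k<t. fps_const (B $$ (a, k)) * Y k b) = (if a = b then ?E else 0)"
      and E': "fps_deriv ?E = fps_const 1 * (\<Sum>a<t. \<Sum>k<t. fps_const (B $$ (a, k)) * Y k a)"
    using char_poly_resolvent_fps[OF B, of 1] by blast
  define X where "X a b = (\<Sum>k<t. fps_const (B $$ (a, k)) * Y k b)" for a b
  have "X a b = fps_const (B $$ (a, b)) * ?E + fps_const (- 1) * fps_X * (\<Sum>c<t. fps_const (B $$ (a, c)) * X c b)"
    if "a < t" "b < t" for a b
  proof -
    have "X a b = (\<Sum>k<t. fps_const (B $$ (a, k)) * ((if k = b then ?E else 0) - fps_X * X k b))"
      unfolding X_def[of a b] using Y that
      by (intro sum.cong refl arg_cong2[where f = "(*)"]) (simp add: X_def eq_diff_eq)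
    also have "\<dots> = (\<Sum>k<t. (if k = b then fps_const (B $$ (a, k)) * ?E else 0)) -
        fps_X * (\<Sum>c<t. fps_const (B $$ (a, c)) * X c b)"
      unfolding sum_distrib_left sum_subtractf[symmetric]
      by (intro sum.cong refl) (simp add: algebra_simps)
    finally show ?thesis
      using that by (simp add: sum.delta fps_const_neg[symmetric] del: fps_const_neg)
  qed
  moreover have "fps_nth ?E 0 = 1"
    using degree_monic_char_poly[OF B] B by (simp add: signed_char_coeff_def)
  ultimately have "twisted_trace (- 1) {..<t} (\<lambda>a b. B $$ (a, b)) S = fact (card S) * fps_nth ?E (card S)"
    using E' S by (intro twisted_trace_eq_fps_coeff[where X = X]) (auto simp: X_def)
  then show ?thesis
    by simp
qed

text \<open>This time \<open>(1 - z B) Y = D\<close> and \<open>D' = - tr (B Y)\<close>, so \<open>H = 1 / D\<close> has derivative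
  \<open>H\<^sup>2 tr (B Y)\<close>. This dictates \<open>X = H\<^sup>2 B Y\<close>, and multiplying \<open>(1 - z B) Y = D\<close> by \<open>H\<^sup>2 B\<close> gives
  \<open>X - z B X = H\<^sup>2 D B = H B\<close> as required for \<open>\<epsilon> = 1\<close>. The result is MacMahon's master theorem
  with all its variables set equal to \<open>z\<close>.\<close>

lemma twisted_trace_one:
  fixes B :: "'a::field_char_0 mat"
  assumes B: "B \<in> carrier_mat t t" and S: "finite S"
  shows "twisted_trace 1 {..<t} (\<lambda>a b. B $$ (a, b)) S =
    fact (card S) * fps_nth (inverse (Abs_fps (\<lambda>k. (- 1) ^ k * signed_char_coeff B k))) (card S)"
proof -
  let ?D = "Abs_fps (\<lambda>k. (- 1) ^ k * signed_char_coeff B k)"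
  let ?H = "inverse ?D"
  obtain Y where Y: "\<And>a b. a < t \<Longrightarrow> b < t \<Longrightarrow>
        Y a b + fps_const (- 1) * fps_X * (\<Sum>k<t. fps_const (B $$ (a, k)) * Y k b) = (if a = b then ?D else 0)"
      and D': "fps_deriv ?D = fps_const (- 1) * (\<Sum>a<t. \<Sum>k<t. fps_const (B $$ (a, k)) * Y k a)"
    using char_poly_resolvent_fps[OF B, of "- 1"] by blast
  have D0: "fps_nth ?D 0 = 1"
    using degree_monic_char_poly[OF B] B by (simp add: signed_char_coeff_def)
  have HD: "?H * ?D = 1"
    using D0 by (intro inverse_mult_eq_1) simp
  define Z where "Z a b = (\<Sum>k<t. fps_const (B $$ (a, k)) * Y k b)" for a b
  define X where "X a b = ?H ^ 2 * Z a b" for a b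
  have "X a b = fps_const (B $$ (a, b)) * ?H + fps_const 1 * fps_X * (\<Sum>c<t. fps_const (B $$ (a, c)) * X c b)"
    if "a < t" "b < t" for a b
  proof -
    have Yk: "Y k b = (if k = b then ?D else 0) + fps_X * Z k b" if "k < t" for k
      using Y[OF that \<open>b < t\<close>]
      by (simp add: Z_def fps_const_neg[symmetric] algebra_simps del: fps_const_neg)
    have "Z a b = (\<Sum>k<t. fps_const (B $$ (a, k)) * ((if k = b then ?D else 0) + fps_X * Z k b))"
      unfolding Z_def[of a b] using Yk by (intro sum.cong refl) simp
    also have "\<dots> = (\<Sum>k<t. (if k = b then fps_const (B $$ (a, k)) * ?D else 0)) +
        fps_X * (\<Sum>c<t. fps_const (B $$ (a, c)) * Z c b)"
      unfolding sum_distrib_left sum.distrib[symmetric]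
      by (intro sum.cong refl) (simp add: algebra_simps)
    also have "\<dots> = fps_const (B $$ (a, b)) * ?D + fps_X * (\<Sum>c<t. fps_const (B $$ (a, c)) * Z c b)"
      using that by (simp add: sum.delta)
    finally have "X a b = fps_const (B $$ (a, b)) * ?H * (?H * ?D) +
        fps_X * (\<Sum>c<t. fps_const (B $$ (a, c)) * X c b)"
      by (simp add: X_def sum_distrib_left power2_eq_square algebra_simps)
    then show ?thesis
      unfolding HD by simp
  qed
  moreover have "fps_deriv ?H = (\<Sum>a<t. X a a)"
  proof -
    have "fps_deriv ?H = - fps_deriv ?D * ?H ^ 2"
      using D0 by (intro fps_inverse_deriv) simp
    also have "\<dots> = ?H ^ 2 * (\<Sum>a<t. Z a a)"
      unfolding D' Z_def by (simp add: fps_const_neg[symmetric] mult.commute del: fps_const_neg)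
    finally show ?thesis
      by (simp add: X_def sum_distrib_left)
  qed
  ultimately show ?thesis
    using D0 S by (intro twisted_trace_eq_fps_coeff[where X = X]) auto
qed

section \<open>Expectations over a random Gram matrix\<close>

lemma gram_entry:
  assumes "i < n" "j < n"
  shows "random_gram_matrix t n W x $$ (i, j) = (\<Sum>k<t. W i x k * W j x k)"
  using assms
  by (simp add: random_gram_matrix_def sample_matrix_def scalar_prod_def atLeast0LessThan)

text \<open>Regrouping by samples: sample \<open>j\<close> occurs for row \<open>j\<close>, with coordinate \<open>f j\<close>, and for column \<open>j\<close> in
  the row that \<open>p\<close> maps to \<open>j\<close>, with the coordinate belonging to that row. After this the factors
  for different \<open>i\<close> involve different, hence independent, random vectors.\<close>

lemma gram_permutation_product:
  assumes p: "p permutes {..<n}"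
  shows "(\<Prod>i<n. random_gram_matrix t n W x $$ (i, p i)) =
    (\<Sum>f \<in> {..<n} \<rightarrow>\<^sub>E {..<t}. \<Prod>i<n. W i x (f i) * W i x (f (Hilbert_Choice.inv p i)))"
proof -
  have pn: "p i < n" if "i < n" for i
    using permutes_in_image[OF p, of i] that by simp
  have "(\<Prod>i<n. random_gram_matrix t n W x $$ (i, p i)) = (\<Prod>i<n. \<Sum>k<t. W i x k * W (p i) x k)"
    by (intro prod.cong refl) (simp add: gram_entry pn)
  also have "\<dots> = (\<Sum>f \<in> {..<n} \<rightarrow>\<^sub>E {..<t}. \<Prod>i<n. W i x (f i) * W (p i) x (f i))"
    by (rule prod_sum_PiE) auto
  also have "\<dots> = (\<Sum>f \<in> {..<n} \<rightarrow>\<^sub>E {..<t}. \<Prod>i<n. W i x (f i) * W i x (f (Hilbert_Choice.inv p i)))"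
  proof (rule sum.cong[OF refl])
    fix f
    have "(\<Prod>i<n. W (p i) x (f i)) = (\<Prod>i<n. W i x (f (Hilbert_Choice.inv p i)))"
      using prod.permute[OF p, of "\<lambda>i. W i x (f (Hilbert_Choice.inv p i))"]
      by (simp add: comp_def permutes_inverses[OF p])
    then show "(\<Prod>i<n. W i x (f i) * W (p i) x (f i)) = (\<Prod>i<n. W i x (f i) * W i x (f (Hilbert_Choice.inv p i)))"
      by (simp add: prod.distrib)
  qed
  finally show ?thesis .
qed

text \<open>Each factor of a regrouped product depends on one sample only and has a second moment as its
  expectation, so independence gives integrability of the product from that of the factors. The
  inverse permutation that remains is removed by summing over all permutations, since inversion
  preserves parity.\<close>

lemma expectation_weighted_gram_permutation_sum:
  fixes Q :: "'b measure" and w :: "'b \<Rightarrow> nat \<Rightarrow> real"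
    and P :: "'a measure" and W :: "nat \<Rightarrow> 'a \<Rightarrow> nat \<Rightarrow> real" and \<epsilon> :: real
  assumes w: "w \<in> measurable Q (vec_space t)"
    and moments: "\<And>i j. i < t \<Longrightarrow> j < t \<Longrightarrow> integrable Q (\<lambda>x. w x i * w x j)"
    and P: "prob_space P"
    and indep: "prob_space.indep_vars P (\<lambda>_. vec_space t) W {..<n}"
    and same_distr: "\<And>k. k < n \<Longrightarrow> distr P (vec_space t) (W k) = distr Q (vec_space t) w"
  defines "F \<equiv> \<lambda>x. \<Sum>p | p permutes {..<n}.
      parity_weight \<epsilon> p * (\<Prod>i<n. random_gram_matrix t n W x $$ (i, p i))"
  shows "integrable P F"
    and "prob_space.expectation P F =
      twisted_trace \<epsilon> {..<t} (\<lambda>a b. second_moment_matrix Q t w $$ (a, b)) {..<n}"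
proof -
  interpret P: prob_space P by (rule P)
  have W: "W k \<in> measurable P (vec_space t)" if "k < n" for k
    using indep that by (auto simp: P.indep_vars_def)
  have prod_meas: "(\<lambda>v. v a * v b) \<in> borel_measurable (vec_space t)" if "a < t" "b < t" for a b
    using that by (intro borel_measurable_times measurable_component_singleton) auto
  have int1: "integrable P (\<lambda>x. W k x a * W k x b)" and
    exp1: "P.expectation (\<lambda>x. W k x a * W k x b) = second_moment_matrix Q t w $$ (a, b)"
    if "k < n" "a < t" "b < t" for k a b
  proof -
    note meas = prod_meas[OF that(2,3)]
    have "integrable (distr P (vec_space t) (W k)) (\<lambda>v. v a * v b)"
      unfolding same_distr[OF that(1)] using moments[OF that(2,3)]
      by (simp add: integrable_distr_eq[OF w meas])
    then show "integrable P (\<lambda>x. W k x a * W k x b)"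
      by (simp add: integrable_distr_eq[OF W[OF that(1)] meas])
    have "P.expectation (\<lambda>x. W k x a * W k x b) = (\<integral>v. v a * v b \<partial>distr P (vec_space t) (W k))"
      by (simp add: integral_distr[OF W[OF that(1)] meas])
    also have "\<dots> = (\<integral>x. w x a * w x b \<partial>Q)"
      unfolding same_distr[OF that(1)] by (simp add: integral_distr[OF w meas])
    finally show "P.expectation (\<lambda>x. W k x a * W k x b) = second_moment_matrix Q t w $$ (a, b)"
      using that by (simp add: second_moment_matrix_def)
  qed
  have intf: "integrable P (\<lambda>x. \<Prod>i<n. W i x (f i) * W i x (g i))" and
    expf: "P.expectation (\<lambda>x. \<Prod>i<n. W i x (f i) * W i x (g i)) =
      (\<Prod>i<n. second_moment_matrix Q t w $$ (f i, g i))"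
    if fg: "\<And>i. i < n \<Longrightarrow> f i < t" "\<And>i. i < n \<Longrightarrow> g i < t" for f g
  proof -
    have ind: "P.indep_vars (\<lambda>_. borel) (\<lambda>i x. W i x (f i) * W i x (g i)) {..<n}"
      using P.indep_vars_compose2[OF indep, of "\<lambda>i v. v (f i) * v (g i)" "\<lambda>_. borel"] prod_meas fg
      by auto
    have int: "integrable P (\<lambda>x. W i x (f i) * W i x (g i))" if "i \<in> {..<n}" for i
      using that fg by (intro int1) auto
    show "integrable P (\<lambda>x. \<Prod>i<n. W i x (f i) * W i x (g i))"
      by (rule P.indep_vars_integrable[OF _ ind int]) simp
    have "P.expectation (\<lambda>x. \<Prod>i<n. W i x (f i) * W i x (g i)) =
        (\<Prod>i<n. P.expectation (\<lambda>x. W i x (f i) * W i x (g i)))"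
      by (rule P.indep_vars_lebesgue_integral[OF _ ind int]) simp
    also have "\<dots> = (\<Prod>i<n. second_moment_matrix Q t w $$ (f i, g i))"
      using fg by (intro prod.cong refl exp1) auto
    finally show "P.expectation (\<lambda>x. \<Prod>i<n. W i x (f i) * W i x (g i)) =
      (\<Prod>i<n. second_moment_matrix Q t w $$ (f i, g i))" .
  qed
  have bounds: "f i < t" "f (Hilbert_Choice.inv p i) < t"
    if "f \<in> {..<n} \<rightarrow>\<^sub>E {..<t}" "p permutes {..<n}" "i < n" for f p i
    using that permutes_in_image[OF permutes_inv[OF that(2)], of i] by (auto simp: PiE_iff)
  have F: "F = (\<lambda>x. \<Sum>p | p permutes {..<n}. \<Sum>f \<in> {..<n} \<rightarrow>\<^sub>E {..<t}.
      parity_weight \<epsilon> p * (\<Prod>i<n. W i x (f i) * W i x (f (Hilbert_Choice.inv p i))))"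
    unfolding F_def by (intro ext sum.cong refl) (simp add: gram_permutation_product sum_distrib_left)
  show "integrable P F"
    unfolding F by (intro Bochner_Integration.integrable_sum integrable_mult_right intf)
      (auto simp: bounds)
  have "P.expectation F = (\<Sum>p | p permutes {..<n}. \<Sum>f \<in> {..<n} \<rightarrow>\<^sub>E {..<t}.
      parity_weight \<epsilon> p * (\<Prod>i<n. second_moment_matrix Q t w $$ (f i, f (Hilbert_Choice.inv p i))))"
    unfolding F
    by (subst Bochner_Integration.integral_sum,
        (intro Bochner_Integration.integrable_sum integrable_mult_right intf; simp add: bounds),
        intro sum.cong refl)+ (simp add: expf bounds)
  also have "\<dots> = (\<Sum>f \<in> {..<n} \<rightarrow>\<^sub>E {..<t}. \<Sum>p | p permutes {..<n}.
      parity_weight \<epsilon> p * (\<Prod>i<n. second_moment_matrix Q t w $$ (f i, f (Hilbert_Choice.inv p i))))"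
    by (rule sum.swap)
  also have "\<dots> = twisted_trace \<epsilon> {..<t} (\<lambda>a b. second_moment_matrix Q t w $$ (a, b)) {..<n}"
    unfolding twisted_trace_def
  proof (rule sum.cong[OF refl])
    fix f
    show "(\<Sum>p | p permutes {..<n}.
        parity_weight \<epsilon> p * (\<Prod>i<n. second_moment_matrix Q t w $$ (f i, f (Hilbert_Choice.inv p i)))) =
      (\<Sum>p | p permutes {..<n}.
        parity_weight \<epsilon> p * (\<Prod>i<n. second_moment_matrix Q t w $$ (f i, f (p i))))"
    proof (subst sum_permutations_inverse, intro sum.cong refl)
      fix p assume "p \<in> {p. p permutes {..<n}}"
      then have p: "p permutes {..<n}" by simp
      then have "permutation p"
        by (auto simp: permutation_permutes)
      then show "parity_weight \<epsilon> (Hilbert_Choice.inv p) * (\<Prod>i<n. second_moment_matrix Q t w $$ (f i, f (Hilbert_Choice.inv (Hilbert_Choice.inv p) i))) =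
          parity_weight \<epsilon> p * (\<Prod>i<n. second_moment_matrix Q t w $$ (f i, f (p i)))"
        by (simp add: parity_weight_def evenperm_inv permutes_inv_inv[OF p])
    qed
  qed
  finally show "P.expectation F =
      twisted_trace \<epsilon> {..<t} (\<lambda>a b. second_moment_matrix Q t w $$ (a, b)) {..<n}" .
qed

lemma det_eq_weighted_permutation_sum:
  assumes "B \<in> carrier_mat n n"
  shows "Determinant.det B =
    (\<Sum>p | p permutes {..<n}. parity_weight (- 1) p * (\<Prod>i<n. B $$ (i, p i)))"
  unfolding det_def'[OF assms] atLeast0LessThan
  by (intro sum.cong refl) (simp add: parity_weight_def sign_def)

lemma perm_eq_weighted_permutation_sum:
  assumes "B \<in> carrier_mat n n"
  shows "perm B = (\<Sum>p | p permutes {..<n}. parity_weight 1 p * (\<Prod>i<n. B $$ (i, p i)))"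
  using assms by (simp add: perm_def parity_weight_def atLeast0LessThan)

theorem theorem3:
  fixes Q :: "'b measure" and w :: "'b \<Rightarrow> nat \<Rightarrow> real"
    and P :: "'a measure" and W :: "nat \<Rightarrow> 'a \<Rightarrow> nat \<Rightarrow> real"
    and t n :: nat and c :: "nat \<Rightarrow> real"
  assumes t: "t \<ge> 1"
    and Q: "prob_space Q"
    and w: "w \<in> measurable Q (vec_space t)"
    and moments: "\<And>i j. i < t \<Longrightarrow> j < t \<Longrightarrow> integrable Q (\<lambda>x. w x i * w x j)"
    and P: "prob_space P"
    and indep: "prob_space.indep_vars P (\<lambda>_. vec_space t) W {..<n}"
    and same_distr: "\<And>k. k < n \<Longrightarrow> distr P (vec_space t) (W k) = distr Q (vec_space t) w"
    and c: "c = signed_char_coeff (second_moment_matrix Q t w)"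
  shows "integrable P (\<lambda>x. Determinant.det (random_gram_matrix t n W x))
    \<and> prob_space.expectation P (\<lambda>x. Determinant.det (random_gram_matrix t n W x)) = fact n * c n
    \<and> integrable P (\<lambda>x. perm (random_gram_matrix t n W x))
    \<and> prob_space.expectation P (\<lambda>x. perm (random_gram_matrix t n W x)) =
        fact n * fps_nth (inverse (1 + (\<Sum>k = 1..t. fps_const ((- 1) ^ k * c k) * fps_X ^ k))) n"
proof -
  let ?G = "random_gram_matrix t n W"
  let ?B = "second_moment_matrix Q t w"
  have G: "?G x \<in> carrier_mat n n" for x
    by (rule carrier_matI) (simp_all add: random_gram_matrix_def sample_matrix_def)
  have B: "?B \<in> carrier_mat t t"
    by (simp add: second_moment_matrix_def)
  note weighted = expectation_weighted_gram_permutation_sum[OF w moments P indep same_distr]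
  have c0: "c 0 = 1"
    using degree_monic_char_poly[OF B] B by (simp add: c signed_char_coeff_def)
  have c_top: "c k = 0" if "t < k" for k
    using B that by (simp add: c signed_char_coeff_def)
  have D: "1 + (\<Sum>k = 1..t. fps_const ((- 1) ^ k * c k) * fps_X ^ k) = Abs_fps (\<lambda>k. (- 1) ^ k * c k)"
    (is "?L = ?R")
  proof (rule fps_ext)
    fix m
    show "fps_nth ?L m = fps_nth ?R m"
      using c_top[of m] c0 by (cases "m = 0") (auto simp: fps_sum_nth mult_delta_right)
  qed
  show ?thesis
    using weighted[of "- 1"] weighted[of 1] twisted_trace_minus_one[OF B, of "{..<n}"]
      twisted_trace_one[OF B, of "{..<n}"]
    unfolding D by (simp add: det_eq_weighted_permutation_sum[OF G] perm_eq_weighted_permutation_sum[OF G] c)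
qed

end
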